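(* Let $\mathbf{\Phi}$ be a finite set of $1$-dimensional semialgebraic predicates that is Erdős–Szekeres. Then there exists a number $C=C(\mathbf{\Phi})$ such that for every $n\ge 1$, $$\mathrm{ES}_{\mathbf{\Phi}}(n)\le 2^{2^{Cn}}.$$
   Context: A $d$-dimensional $k$-ary semialgebraic predicate $\Phi(\mathbf{x}_1,\ldots,\mathbf{x}_k)$, $\mathbf{x}_i\in\mathbb{R}^d$, is a Boolean combination of polynomial equations and inequalities (polynomials with rational coefficients) in the $dk$ coordinates of $\mathbf{x}_1,\ldots,\mathbf{x}_k$. For $d=1$ the arguments are real numbers. A $k$-ary predicate $\Phi$ holds everywhere on a sequence $(a_1,\ldots,a_n)$ if $\Phi(a_{i_1},\ldots,a_{i_k})$ holds for every $1\le i_1<i_2<\cdots<i_k\le n$. A finite set $\mathbf{\Phi}$ of predicates (possibly of different arities) is Erdős–Szekeres if for every $n$ there exists $N$ such that every sequence of length $N$ has a subsequence (not necessarily contiguous) of length $n$ on which some $\Phi\in\mathbf{\Phi}$ holds everywhere; $\mathrm{ES}_{\mathbf{\Phi}}(n)$ denotes the smallest such $N$. *)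

theory Defs
  imports Complex_Main "HOL-Library.Poly_Mapping" "HOL-Library.Sublist"
begin

(* Polynomials in the variables x_0, x_1, ... with rational coefficients: finitely
   supported maps from monomials (finitely supported exponent vectors) to coefficients. *)
type_synonym rat_mpoly = "(nat \<Rightarrow>\<^sub>0 nat) \<Rightarrow>\<^sub>0 rat"

definition mpoly_vars :: "rat_mpoly \<Rightarrow> nat set" where
  "mpoly_vars p = (\<Union>m \<in> Poly_Mapping.keys p. Poly_Mapping.keys m)"

definition mpoly_eval :: "rat_mpoly \<Rightarrow> (nat \<Rightarrow> real) \<Rightarrow> real" where
  "mpoly_eval p x =
     (\<Sum>m \<in> Poly_Mapping.keys p. of_rat (Poly_Mapping.lookup p m) *
        (\<Prod>i \<in> Poly_Mapping.keys m. x i ^ Poly_Mapping.lookup m i))"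

datatype sa_formula =
    PolyEq rat_mpoly
  | PolyGt rat_mpoly
  | PolyGe rat_mpoly
  | Neg sa_formula
  | Conj sa_formula sa_formula
  | Disj sa_formula sa_formula

primrec sa_vars :: "sa_formula \<Rightarrow> nat set" where
  "sa_vars (PolyEq p) = mpoly_vars p"
| "sa_vars (PolyGt p) = mpoly_vars p"
| "sa_vars (PolyGe p) = mpoly_vars p"
| "sa_vars (Neg f) = sa_vars f"
| "sa_vars (Conj f g) = sa_vars f \<union> sa_vars g"
| "sa_vars (Disj f g) = sa_vars f \<union> sa_vars g"

primrec sa_holds :: "sa_formula \<Rightarrow> (nat \<Rightarrow> real) \<Rightarrow> bool" where
  "sa_holds (PolyEq p) x \<longleftrightarrow> mpoly_eval p x = 0"
| "sa_holds (PolyGt p) x \<longleftrightarrow> mpoly_eval p x > 0"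
| "sa_holds (PolyGe p) x \<longleftrightarrow> mpoly_eval p x \<ge> 0"
| "sa_holds (Neg f) x \<longleftrightarrow> \<not> sa_holds f x"
| "sa_holds (Conj f g) x \<longleftrightarrow> sa_holds f x \<and> sa_holds g x"
| "sa_holds (Disj f g) x \<longleftrightarrow> sa_holds f x \<or> sa_holds g x"

(* A k-ary predicate is a pair (k, P), where P is only ever applied to lists of length k;
   its values on other lists are irrelevant. *)
type_synonym 'a predicate = "nat \<times> ('a list \<Rightarrow> bool)"

definition arity :: "'a predicate \<Rightarrow> nat" where
  "arity \<phi> = fst \<phi>"

definition pred_holds :: "'a predicate \<Rightarrow> 'a list \<Rightarrow> bool" where
  "pred_holds \<phi> = snd \<phi>"

(* The one-dimensional case: the arguments are real numbers, argument i (counted from 0)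
   being the value of the variable x_i. *)
definition semialgebraic1 :: "real predicate \<Rightarrow> bool" where
  "semialgebraic1 \<phi> \<longleftrightarrow>
     (\<exists>f. sa_vars f \<subseteq> {..<arity \<phi>} \<and>
          (\<forall>xs. length xs = arity \<phi> \<longrightarrow>
             (pred_holds \<phi> xs \<longleftrightarrow> sa_holds f (\<lambda>i. xs ! i))))"

definition holds_everywhere :: "'a predicate \<Rightarrow> 'a list \<Rightarrow> bool" where
  "holds_everywhere \<phi> as \<longleftrightarrow>
     (\<forall>is. length is = arity \<phi> \<and> set is \<subseteq> {..<length as} \<and> sorted_wrt (<) is \<longrightarrow>
        pred_holds \<phi> (map (\<lambda>i. as ! i) is))"

(* subseq is the library's not necessarily contiguous subsequence relation. *)
definition ES_property :: "'a predicate set \<Rightarrow> nat \<Rightarrow> nat \<Rightarrow> bool" where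
  "ES_property \<Phi> n N \<longleftrightarrow>
     (\<forall>as. length as = N \<longrightarrow>
        (\<exists>bs. subseq bs as \<and> length bs = n \<and> (\<exists>\<phi>\<in>\<Phi>. holds_everywhere \<phi> bs)))"

definition erdos_szekeres :: "'a predicate set \<Rightarrow> bool" where
  "erdos_szekeres \<Phi> \<longleftrightarrow> (\<forall>n. \<exists>N. ES_property \<Phi> n N)"

definition ES :: "'a predicate set \<Rightarrow> nat \<Rightarrow> nat" where
  "ES \<Phi> n = (LEAST N. ES_property \<Phi> n N)"

end

(*
  It suffices to find, among doubly exponentially many reals, n terms on which the sign of each
  polynomial occurring in the predicates is the same at all increasing index tuples: a single
  tuple satisfying some predicate, which exists by the Erdos-Szekeres property applied with n the
  maximal arity, then forces that predicate to hold everywhere.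

  Repeatedly bisecting the range of N distinct reals yields a point a and about log N of the terms
  whose distances to a differ pairwise by a large factor. The logarithms y of these distances are
  separated by gaps, and can be made monotone. Bisecting the range of y in the same way gives
  about log log N terms with x = a + r exp z, where the z have constant sign, are large and grow
  (or decay) by a large factor D from one to the next. A polynomial in such terms is a sum of
  monomials c exp(sum b_j z_j) whose exponent vectors b range over a set independent of a and r.
  The log-ratio of two monomials is ln |c/c'| plus a nonzero integer combination of values of z;
  after passing to a constant proportion of the indices, on which every |z| is much larger or every
  |z| is much smaller than each |ln |c/c'||, it is large with a sign independent of the tuple, so
  that the same monomial dominates at all tuples.
*)

theory Submission
  imports Defs "HOL-Library.FuncSet"
begin

section \<open>Extracting separated and monotone subsequences\<close>

lemma ex_large_fibre:
  assumes "finite I" "finite C" "C \<noteq> {}" "g ` I \<subseteq> C" "card C * m \<le> card I"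
  shows "\<exists>c\<in>C. m \<le> card {i \<in> I. g i = c}"
proof -
  have "g \<in> I \<rightarrow> C" using assms(4) by auto
  from pigeonhole_card[OF this assms(1-3)]
  obtain c where c: "c \<in> C" "card I \<le> card (g -` {c} \<inter> I) * card C" by auto
  moreover have "g -` {c} \<inter> I = {i \<in> I. g i = c}" by auto
  ultimately have "card C * m \<le> card C * card {i \<in> I. g i = c}"
    using assms(5) by (metis le_trans mult.commute)
  moreover have "card C > 0" using assms(2,3) by auto
  ultimately show ?thesis using c(1) by auto
qed

text \<open>The monotone subsequence theorem. The induction peels off the left-to-right minima:
  unless more than \<open>s\<close> of them already form a long decreasing chain, more than
  \<open>r * s\<close> indices survive.\<close>

lemma erdos_szekeres_monotone:
  fixes f :: "nat \<Rightarrow> real"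
  assumes "finite I" "inj_on f I" "r * s < card I"
  shows "(\<exists>J\<subseteq>I. card J = Suc r \<and> (\<forall>i\<in>J. \<forall>j\<in>J. i < j \<longrightarrow> f i < f j)) \<or>
         (\<exists>J\<subseteq>I. card J = Suc s \<and> (\<forall>i\<in>J. \<forall>j\<in>J. i < j \<longrightarrow> f j < f i))"
  using assms
proof (induction r arbitrary: I)
  case 0
  then obtain i where "i \<in> I" by fastforce
  then show ?case by (intro disjI1 exI[of _ "{i}"]) auto
next
  case (Suc r)
  (* A is decreasing, and every increasing chain outside A can be prolonged at its start *)
  define A where "A = {i \<in> I. \<not> (\<exists>j\<in>I. j < i \<and> f j < f i)}"
  have A: "A \<subseteq> I" "finite A" using Suc.prems by (auto simp: A_def)
  have desc: "\<forall>i\<in>A. \<forall>j\<in>A. i < j \<longrightarrow> f j < f i"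
  proof (intro ballI impI)
    fix i j assume "i \<in> A" "j \<in> A" "i < j"
    then have "\<not> f i < f j" "f i \<noteq> f j" "i \<in> I"
      using inj_onD[OF Suc.prems(2), of i j] by (auto simp: A_def)
    then show "f j < f i" by simp
  qed
  show ?case
  proof (cases "s < card A")
    case True
    then obtain J where "J \<subseteq> A" "card J = Suc s"
      by (meson Suc_leI obtain_subset_with_card_n)
    then show ?thesis using A desc by (intro disjI2 exI[of _ J]) blast
  next
    case False
    have "card (I - A) = card I - card A" using A by (simp add: card_Diff_subset)
    then have "r * s < card (I - A)" using Suc.prems False by simp
    moreover have "inj_on f (I - A)" using Suc.prems(2) by (simp add: inj_on_diff)
    ultimately consider
      J where "J \<subseteq> I - A" "card J = Suc r" "\<forall>i\<in>J. \<forall>j\<in>J. i < j \<longrightarrow> f i < f j" |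
      J where "J \<subseteq> I - A" "card J = Suc s" "\<forall>i\<in>J. \<forall>j\<in>J. i < j \<longrightarrow> f j < f i"
      using Suc.IH[of "I - A"] Suc.prems(1) by blast
    then show ?thesis
    proof cases
      case (1 J)
      then have fin: "finite J" and ne: "J \<noteq> {}" by (auto intro: card_ge_0_finite)
      define m where "m = Min J"
      have m: "m \<in> J" "\<And>i. i \<in> J \<Longrightarrow> m \<le> i" using fin ne by (auto simp: m_def)
      then have "m \<in> I - A" using 1(1) by blast
      then obtain j where j: "j \<in> I" "j < m" "f j < f m" unfolding A_def by blast
      have notin: "j \<notin> J" using m(2) j(2) by fastforce
      have "f j < f i" if "i \<in> J" for i
        using m that j 1(3) by (metis less_trans order.order_iff_strict)
      moreover have "j < i" if "i \<in> J" for i using m(2)[OF that] j(2) by simp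
      ultimately have "\<forall>i\<in>insert j J. \<forall>i'\<in>insert j J. i < i' \<longrightarrow> f i < f i'"
        using 1(3) by (auto dest: less_asym)
      then show ?thesis using 1 j fin notin
        by (intro disjI1 exI[of _ "insert j J"]) auto
    next
      case (2 J)
      then show ?thesis by blast
    qed
  qed
qed

text \<open>Pairs are compared in either direction, as the construction below gives no control over
  the index order. Zeros pass the test, so nonvanishing has to be ensured separately.\<close>

definition separated :: "nat \<Rightarrow> 'i set \<Rightarrow> ('i \<Rightarrow> real) \<Rightarrow> bool" where
  "separated D J z \<longleftrightarrow> (\<forall>i\<in>J. \<forall>j\<in>J. i \<noteq> j \<longrightarrow>
     real D * \<bar>z i\<bar> \<le> \<bar>z j\<bar> \<or> real D * \<bar>z j\<bar> \<le> \<bar>z i\<bar>)"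

text \<open>Cut the range of \<open>f\<close>, of width \<open>w\<close>, into pieces of width
  \<open>w / (2 * D)\<close> and recurse inside a fullest one. Its points lie within
  \<open>w / (2 * D)\<close> of the centre \<open>p\<close> found there, while one end of the range
  is at least \<open>w / 2\<close> away from all of them. Adding this end keeps the ratios at least
  \<open>D\<close> and costs one factor \<open>2 * D + 1\<close>.\<close>

lemma ex_separated:
  fixes f :: "'i \<Rightarrow> real"
  assumes "finite I" "inj_on f I" "D \<ge> 1" "(2 * D + 1) ^ n \<le> card I"
  shows "\<exists>p\<in>I. \<exists>J\<subseteq>I - {p}. card J = n \<and> separated D J (\<lambda>i. f i - f p)"
  using assms
proof (induction n arbitrary: I)
  case 0
  then obtain p where "p \<in> I" by fastforce
  then show ?case by (intro bexI[of _ p] exI[of _ "{}"]) (auto simp: separated_def)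
next
  case (Suc n)
  have "0 < (2 * D + 1) ^ n" by simp
  then have "2 * 1 \<le> (2 * D + 1) * (2 * D + 1) ^ n" using Suc.prems(3) by (intro mult_le_mono) auto
  then have card2: "2 \<le> card I" using Suc.prems(4) by simp
  then have fimg: "finite (f ` I)" "f ` I \<noteq> {}" using Suc.prems(1) by auto
  obtain lo where lo: "lo \<in> I" "f lo = Min (f ` I)" using Min_in[OF fimg] by auto
  obtain hi where hi: "hi \<in> I" "f hi = Max (f ` I)" using Max_in[OF fimg] by auto
  have bnd: "f lo \<le> f i" "f i \<le> f hi" if "i \<in> I" for i
    using fimg that lo hi by auto
  define w where "w = f hi - f lo"
  have "w > 0"
  proof (rule ccontr)
    assume "\<not> w > 0"
    then have "f i = f lo" if "i \<in> I" for i using bnd[OF that] by (simp add: w_def)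
    then have "I \<subseteq> {lo}" using Suc.prems(2) lo(1) by (auto dest: inj_onD)
    then have "card I \<le> card {lo}" by (rule card_mono[rotated]) simp
    then show False using card2 by simp
  qed
  \<comment> \<open>The piece containing \<open>f i\<close>. Index \<open>2 * D\<close> is attained
    only at the maximum of \<open>f\<close>, whence \<open>2 * D + 1\<close> pieces.\<close>
  define g where "g i = nat \<lfloor>2 * real D * (f i - f lo) / w\<rfloor>" for i
  have Dpos: "real D > 0" using Suc.prems(3) by simp
  have g: "real (g i) * w \<le> 2 * real D * (f i - f lo)"
       "2 * real D * (f i - f lo) < (real (g i) + 1) * w" if "i \<in> I" for i
  proof -
    have nn: "0 \<le> 2 * real D * (f i - f lo) / w" using bnd(1)[OF that] \<open>w > 0\<close> by simp
    then have "real (g i) \<le> 2 * real D * (f i - f lo) / w"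
         "2 * real D * (f i - f lo) / w < real (g i) + 1"
      by (auto simp: g_def)
    then show "real (g i) * w \<le> 2 * real D * (f i - f lo)"
       "2 * real D * (f i - f lo) < (real (g i) + 1) * w"
      using \<open>w > 0\<close> by (simp_all add: field_simps)
  qed
  have "g i \<le> 2 * D" if "i \<in> I" for i
  proof -
    have "2 * real D * (f i - f lo) \<le> 2 * real D * w"
      using bnd(2)[OF that] Dpos by (simp add: w_def)
    then have "real (g i) * w \<le> 2 * real D * w" using g(1)[OF that] by simp
    then have "real (g i) \<le> 2 * real D" using \<open>w > 0\<close> by simp
    then show ?thesis by linarith
  qed
  then have "g ` I \<subseteq> {..2 * D}" by auto
  then obtain c where c: "(2 * D + 1) ^ n \<le> card {i \<in> I. g i = c}"
    using ex_large_fibre[of I "{..2 * D}" g "(2 * D + 1) ^ n"] Suc.prems(1,4) by auto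
  define A where "A = {i \<in> I. g i = c}"
  have A: "A \<subseteq> I" "finite A" "inj_on f A"
    using Suc.prems by (auto simp: A_def intro: inj_on_subset)
  obtain p J where p: "p \<in> A" and J: "J \<subseteq> A - {p}" "card J = n" "separated D J (\<lambda>i. f i - f p)"
    using Suc.IH[OF A(2,3) Suc.prems(3)] c unfolding A_def by blast
  have near: "real D * \<bar>f i - f p\<bar> \<le> w / 2" if "i \<in> A" for i
  proof -
    have i: "i \<in> I" "g i = c" "p \<in> I" "g p = c" using that p by (auto simp: A_def)
    have "2 * real D * (f i - f p) \<le> w" "2 * real D * (f p - f i) \<le> w"
      using g[OF i(1)] g[OF i(3)] unfolding i(2) i(4) by (simp_all add: algebra_simps)
    then show ?thesis using Dpos by (auto simp: abs_if algebra_simps)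
  qed
  (* whichever end of the range lies in the half not containing the chosen piece *)
  define e where "e = (if D \<le> c then lo else hi)"
  have far: "w / 2 \<le> \<bar>f e - f i\<bar>" if "i \<in> A" for i
  proof (cases "D \<le> c")
    case True
    have i: "i \<in> I" "g i = c" using that by (auto simp: A_def)
    have "real D * w \<le> real c * w" using True \<open>w > 0\<close> by simp
    then have "real D * w \<le> real D * (2 * (f i - f lo))" using g(1)[OF i(1)] i(2) by (simp add: algebra_simps)
    then have "w \<le> 2 * (f i - f lo)" using Dpos by simp
    then show ?thesis using True by (auto simp: e_def abs_if)
  next
    case False
    have i: "i \<in> I" "g i = c" using that by (auto simp: A_def)
    have "(real c + 1) * w \<le> real D * w" using False \<open>w > 0\<close> by simp
    then have "real D * (2 * (f i - f lo)) < real D * w" using g(2)[OF i(1)] i(2) by (simp add: algebra_simps)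
    then have "2 * (f i - f lo) < w" using Dpos by simp
    then show ?thesis using False by (auto simp: e_def w_def abs_if)
  qed
  have e: "e \<in> I" "e \<notin> A" using far[of e] lo hi \<open>w > 0\<close> by (auto simp: e_def)
  have "separated D (insert e J) (\<lambda>i. f i - f p)"
    unfolding separated_def
  proof (intro ballI impI)
    fix i j assume ij: "i \<in> insert e J" "j \<in> insert e J" "i \<noteq> j"
    have *: "real D * \<bar>f i - f p\<bar> \<le> \<bar>f e - f p\<bar>" if "i \<in> J" for i
      using near[of i] far[OF p] that J(1) by force
    show "real D * \<bar>f i - f p\<bar> \<le> \<bar>f j - f p\<bar> \<or> real D * \<bar>f j - f p\<bar> \<le> \<bar>f i - f p\<bar>"
      using ij * J(3) unfolding separated_def by blast
  qed
  moreover have "finite J" "e \<notin> J" using J A e finite_subset by (blast, blast)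
  moreover have "insert e J \<subseteq> I - {p}" using J(1) A(1) e p by blast
  ultimately show ?case using p A(1) J(2)
    by (intro bexI[of _ p] exI[of _ "insert e J"]) auto
qed

section \<open>Signs of integer combinations of a widely spread sequence\<close>

text \<open>Ratios are now tied to the order of the indices, so that which entry of an increasing
  tuple dominates depends on positions alone; the constant sign then fixes the sign of that
  entry.\<close>

definition spread :: "nat \<Rightarrow> nat set \<Rightarrow> (nat \<Rightarrow> real) \<Rightarrow> bool" where
  "spread D J z \<longleftrightarrow>
     ((\<forall>i\<in>J. real D \<le> z i) \<or> (\<forall>i\<in>J. z i \<le> - real D)) \<and>
     ((\<forall>i\<in>J. \<forall>j\<in>J. i < j \<longrightarrow> real D * \<bar>z i\<bar> \<le> \<bar>z j\<bar>) \<or>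
      (\<forall>i\<in>J. \<forall>j\<in>J. i < j \<longrightarrow> real D * \<bar>z j\<bar> \<le> \<bar>z i\<bar>))"

lemma spread_subset: "spread D J z \<Longrightarrow> K \<subseteq> J \<Longrightarrow> spread D K z"
  unfolding spread_def by (meson subsetD)

text \<open>The threshold \<open>h\<close> will be the size of a log-ratio of two coefficients: it
  is negligible against all values of \<open>z\<close>, or all of them are negligible against
  it.\<close>

definition avoids :: "nat \<Rightarrow> nat set \<Rightarrow> (nat \<Rightarrow> real) \<Rightarrow> real \<Rightarrow> bool" where
  "avoids D J z h \<longleftrightarrow> (\<forall>i\<in>J. real D * h \<le> \<bar>z i\<bar>) \<or> (\<forall>i\<in>J. real D * \<bar>z i\<bar> \<le> h)"

lemma avoids_subset: "avoids D J z h \<Longrightarrow> K \<subseteq> J \<Longrightarrow> avoids D K z h"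
  unfolding avoids_def by blast


text \<open>Indices fall into three classes: \<open>|z i|\<close> far above \<open>h\<close>, far
  below it, or strictly between \<open>h / D\<close> and \<open>D * h\<close>. Three indices of the
  last class would change \<open>|z|\<close> by a factor of at least \<open>D ^ 2\<close>, which
  does not fit into that window; so a class with at least 3 members is one of the first two.\<close>

lemma spread_ex_avoids_single:
  assumes "spread D J z" "finite J" "D \<ge> 2" "3 * n \<le> card J" "n \<ge> 3"
  shows "\<exists>K\<subseteq>J. n \<le> card K \<and> avoids D K z h"
proof -
  define g :: "nat \<Rightarrow> nat" where
    "g i = (if real D * h \<le> \<bar>z i\<bar> then 0 else if real D * \<bar>z i\<bar> \<le> h then 1 else 2)" for i
  have "\<exists>c\<in>{0,1,2}. n \<le> card {i \<in> J. g i = c}"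
    using assms(2,4) by (intro ex_large_fibre) (auto simp: g_def)
  then obtain c where c: "c \<in> {0,1,2}" "n \<le> card {i \<in> J. g i = c}" by blast
  define K where "K = {i \<in> J. g i = c}"
  have K: "K \<subseteq> J" "finite K" using assms(2) by (auto simp: K_def)
  have "c \<noteq> 2"
  proof
    assume "c = 2"
    then have mid: "\<bar>z i\<bar> < real D * h" "h < real D * \<bar>z i\<bar>" if "i \<in> K" for i
      using that by (auto simp: K_def g_def split: if_splits)
    have "3 \<le> card K" using c(2) assms(5) by (simp add: K_def)
    then obtain T where T: "T \<subseteq> K" "card T = 3" by (meson obtain_subset_with_card_n)
    then have finT: "finite T" using K(2) finite_subset by blast
    define l where "l = Min T"
    define u where "u = Max T"
    have "T \<noteq> {}" using T by auto
    then have lu: "l \<in> T" "u \<in> T" "\<And>t. t \<in> T \<Longrightarrow> l \<le> t \<and> t \<le> u"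
      using finT by (auto simp: l_def u_def)
    have "card {l, u} \<le> 2" by (simp add: card_insert_if)
    then have "\<not> T \<subseteq> {l, u}" using card_mono[of "{l,u}" T] T(2) by auto
    then obtain m where "m \<in> T" "m \<noteq> l" "m \<noteq> u" by blast
    then have m: "m \<in> T" "l < m" "m < u" using lu(3)[of m] by auto
    have sub: "l \<in> J" "m \<in> J" "u \<in> J" using lu m T K by auto
    have D0: "real D > 0" using assms(3) by simp
    have contra: False if "i \<in> T" "k \<in> T" "real D * \<bar>z i\<bar> \<le> \<bar>z m\<bar>" "real D * \<bar>z m\<bar> \<le> \<bar>z k\<bar>" for i k
    proof -
      have "h < real D * \<bar>z i\<bar>" "\<bar>z k\<bar> < real D * h" using mid that T(1) by auto
      then have "real D * h < real D * \<bar>z m\<bar>" using that(3) D0 by simp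
      then show False using that(4) \<open>\<bar>z k\<bar> < real D * h\<close> by linarith
    qed
    then show False using assms(1) lu(1,2) m sub unfolding spread_def by blast
  qed
  then have "avoids D K z h" using c(1)
    by (auto simp: avoids_def K_def g_def split: if_splits)
  then show ?thesis using K c(2) unfolding K_def by blast
qed

lemma spread_ex_avoids:
  assumes "finite H" "spread D J z" "finite J" "D \<ge> 2" "3 ^ card H * n \<le> card J" "n \<ge> 3"
  shows "\<exists>K\<subseteq>J. n \<le> card K \<and> (\<forall>h\<in>H. avoids D K z h)"
  using assms
proof (induction H arbitrary: J rule: finite_induct)
  case empty
  then show ?case by (intro exI[of _ J]) auto
next
  case (insert h H)
  have "3 * (3 ^ card H * n) \<le> card J" using insert.prems insert.hyps by (simp add: mult.assoc)
  moreover have "1 * 3 \<le> 3 ^ card H * n" using insert.prems by (intro mult_le_mono) auto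
  ultimately obtain K where K: "K \<subseteq> J" "3 ^ card H * n \<le> card K" "avoids D K z h"
    using spread_ex_avoids_single[of D J z "3 ^ card H * n" h] insert.prems by auto
  obtain L where "L \<subseteq> K" "n \<le> card L" "\<forall>h\<in>H. avoids D L z h"
    using insert.IH[of K] K insert.prems spread_subset finite_subset by meson
  then show ?case using K avoids_subset by (intro exI[of _ L]) auto
qed

definition increasing_tuple :: "nat \<Rightarrow> nat set \<Rightarrow> (nat \<Rightarrow> nat) \<Rightarrow> bool" where
  "increasing_tuple k J u \<longleftrightarrow> u ` {..<k} \<subseteq> J \<and> strict_mono_on {..<k} u"

text \<open>A nonzero integer is at least 1 in absolute value, so the outermost position with
  nonzero coefficient outweighs the rest of the sum by the choice of \<open>D\<close>. By
  \<open>avoids\<close>, the offset \<open>h\<close> is either swamped by this term too or swamps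
  the entire sum. In both cases the sign does not depend on the tuple.\<close>

lemma log_ratio_sign:
  fixes a :: "nat \<Rightarrow> int"
  assumes sp: "spread D J z" and av: "avoids D J z \<bar>h\<bar>"
    and D: "2 * (k * d + 1) \<le> D"
    and a: "\<And>j. j < k \<Longrightarrow> \<bar>a j\<bar> \<le> int d" and nz: "\<exists>j<k. a j \<noteq> 0"
  shows "(\<forall>u. increasing_tuple k J u \<longrightarrow> h + (\<Sum>j<k. of_int (a j) * z (u j)) \<ge> real D / 2) \<or>
         (\<forall>u. increasing_tuple k J u \<longrightarrow> h + (\<Sum>j<k. of_int (a j) * z (u j)) \<le> - (real D / 2))"
proof -
  define S where "S = {j. j < k \<and> a j \<noteq> 0}"
  have S: "finite S" "S \<noteq> {}" "S \<subseteq> {..<k}" using nz by (auto simp: S_def)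
  \<comment> \<open>The dominant position is the last one in the support of \<open>a\<close> if
    \<open>|z|\<close> grows and the first one if it decays, simultaneously for all tuples.\<close>
  obtain t where t: "t \<in> S"
    and dom: "\<And>u j. increasing_tuple k J u \<Longrightarrow> j \<in> S \<Longrightarrow> j \<noteq> t \<Longrightarrow> real D * \<bar>z (u j)\<bar> \<le> \<bar>z (u t)\<bar>"
  proof -
    from sp consider "\<forall>i\<in>J. \<forall>j\<in>J. i < j \<longrightarrow> real D * \<bar>z i\<bar> \<le> \<bar>z j\<bar>"
      | "\<forall>i\<in>J. \<forall>j\<in>J. i < j \<longrightarrow> real D * \<bar>z j\<bar> \<le> \<bar>z i\<bar>"
      unfolding spread_def by blast
    then show thesis
    proof cases
      case 1
      show thesis
      proof (rule that[of "Max S"])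
        show "Max S \<in> S" using S by simp
        fix u j assume u: "increasing_tuple k J u" and j: "j \<in> S" "j \<noteq> Max S"
        then have "j < Max S" "Max S \<in> S" using S by (auto simp: order.not_eq_order_implies_strict)
        then have "u j < u (Max S)" "u j \<in> J" "u (Max S) \<in> J"
          using u S(3) j(1) unfolding increasing_tuple_def strict_mono_on_def by auto
        then show "real D * \<bar>z (u j)\<bar> \<le> \<bar>z (u (Max S))\<bar>" using 1 by blast
      qed
    next
      case 2
      show thesis
      proof (rule that[of "Min S"])
        show "Min S \<in> S" using S by simp
        fix u j assume u: "increasing_tuple k J u" and j: "j \<in> S" "j \<noteq> Min S"
        then have "Min S < j" "Min S \<in> S" using S by (auto simp: order.not_eq_order_implies_strict)
        then have "u (Min S) < u j" "u j \<in> J" "u (Min S) \<in> J"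
          using u S(3) j(1) unfolding increasing_tuple_def strict_mono_on_def by auto
        then show "real D * \<bar>z (u j)\<bar> \<le> \<bar>z (u (Min S))\<bar>" using 2 by blast
      qed
    qed
  qed
  have tk: "t < k" "a t \<noteq> 0" using t by (auto simp: S_def)
  have kd: "real D \<ge> 2 * (real k * real d + 1)"
  proof -
    have "real (2 * (k * d + 1)) \<le> real D" using D of_nat_le_iff by blast
    then show ?thesis by simp
  qed
  have "D \<ge> 1" using D by (cases D) auto
  then have D1: "1 \<le> real D" by simp
  have big: "real D \<le> \<bar>z i\<bar>" if "i \<in> J" for i using sp that unfolding spread_def by fastforce
  define f where "f u = (\<Sum>j<k. of_int (a j) * z (u j))" for u
  have in_J: "u j \<in> J" if "increasing_tuple k J u" "j < k" for u j
    using that unfolding increasing_tuple_def by auto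
  have ad: "\<bar>real_of_int (a j)\<bar> \<le> real d" if "j < k" for j using a[OF that] by linarith
  have f_eq: "f u = of_int (a t) * z (u t) + (\<Sum>j\<in>{..<k}-{t}. of_int (a j) * z (u j))" for u
    unfolding f_def using tk(1) by (simp add: sum.remove)
  have rest: "real D * \<bar>\<Sum>j\<in>{..<k}-{t}. of_int (a j) * z (u j)\<bar> \<le> real k * real d * \<bar>z (u t)\<bar>"
    if u: "increasing_tuple k J u" for u
  proof -
    have "real D * \<bar>\<Sum>j\<in>{..<k}-{t}. of_int (a j) * z (u j)\<bar>
          \<le> real D * (\<Sum>j\<in>{..<k}-{t}. \<bar>of_int (a j) * z (u j)\<bar>)"
      by (intro mult_left_mono sum_abs) auto
    also have "\<dots> = (\<Sum>j\<in>{..<k}-{t}. \<bar>of_int (a j)\<bar> * (real D * \<bar>z (u j)\<bar>))"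
      by (simp add: sum_distrib_left abs_mult mult_ac)
    also have "\<dots> \<le> (\<Sum>j\<in>{..<k}-{t}. real d * \<bar>z (u t)\<bar>)"
    proof (intro sum_mono)
      fix j assume j: "j \<in> {..<k} - {t}"
      show "\<bar>of_int (a j)\<bar> * (real D * \<bar>z (u j)\<bar>) \<le> real d * \<bar>z (u t)\<bar>"
      proof (cases "a j = 0")
        case False
        then have "j \<in> S" using j by (auto simp: S_def)
        then show ?thesis using dom[OF u, of j] ad[of j] j by (intro mult_mono) auto
      qed simp
    qed
    also have "\<dots> = real (card ({..<k} - {t})) * (real d * \<bar>z (u t)\<bar>)" by simp
    also have "\<dots> \<le> real k * (real d * \<bar>z (u t)\<bar>)"
      using card_mono[of "{..<k}" "{..<k} - {t}"] by (intro mult_right_mono) auto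
    finally show ?thesis by (simp add: mult.assoc)
  qed
  from av consider (small) "\<forall>i\<in>J. real D * \<bar>h\<bar> \<le> \<bar>z i\<bar>" | (large) "\<forall>i\<in>J. real D * \<bar>z i\<bar> \<le> \<bar>h\<bar>"
    unfolding avoids_def by blast
  then show ?thesis
  proof cases
    case small
    \<comment> \<open>The other terms contribute at most \<open>k * d / D\<close> and
      \<open>h\<close> at most \<open>1 / D\<close> times \<open>|z (u t)|\<close>, together at most
      half of it.\<close>
    have close: "\<bar>h + f u - of_int (a t) * z (u t)\<bar> \<le> \<bar>z (u t)\<bar> / 2" if u: "increasing_tuple k J u" for u
    proof -
      have "real D * \<bar>h + f u - of_int (a t) * z (u t)\<bar>
          \<le> real D * (\<bar>h\<bar> + \<bar>\<Sum>j\<in>{..<k}-{t}. of_int (a j) * z (u j)\<bar>)"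
        by (intro mult_left_mono) (auto simp: f_eq)
      also have "\<dots> \<le> (real k * real d + 1) * \<bar>z (u t)\<bar>"
        using rest[OF u] small in_J[OF u tk(1)] by (simp add: algebra_simps add_mono)
      also have "\<dots> \<le> (real D / 2) * \<bar>z (u t)\<bar>" using kd by (intro mult_right_mono) auto
      finally have "real D * \<bar>h + f u - of_int (a t) * z (u t)\<bar> \<le> real D * (\<bar>z (u t)\<bar> / 2)" by simp
      moreover have "real D > 0" using D1 by linarith
      ultimately show ?thesis by simp
    qed
    have main: "real D / 2 \<le> e * (h + f u)"
      if u: "increasing_tuple k J u" and e: "\<bar>e\<bar> = 1" "e * (of_int (a t) * z (u t)) \<ge> \<bar>z (u t)\<bar>" for u e
    proof -
      have "\<bar>e * (h + f u) - e * (of_int (a t) * z (u t))\<bar> = \<bar>h + f u - of_int (a t) * z (u t)\<bar>"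
        using e(1) by (simp flip: right_diff_distrib add: abs_mult)
      then have "\<bar>e * (h + f u) - e * (of_int (a t) * z (u t))\<bar> \<le> \<bar>z (u t)\<bar> / 2"
        using close[OF u] by simp
      then show ?thesis using e(2) big[OF in_J[OF u tk(1)]] by linarith
    qed
    from sp obtain s :: real where s: "\<bar>s\<bar> = 1" "\<And>i. i \<in> J \<Longrightarrow> s * z i = \<bar>z i\<bar>"
    proof -
      from sp consider "\<forall>i\<in>J. real D \<le> z i" | "\<forall>i\<in>J. z i \<le> - real D" unfolding spread_def by blast
      then show thesis
      proof cases
        case 1 then show thesis using that[of 1] by force
      next
        case 2 then show thesis using that[of "-1"] by force
      qed
    qed
    \<comment> \<open>The sign of the dominant term. As \<open>s\<close> is the common sign of
      \<open>z\<close> on \<open>J\<close>, it is the same for all tuples.\<close>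
    define e where "e = s * sgn (real_of_int (a t))"
    have e1: "\<bar>e\<bar> = 1" using s(1) tk(2) by (simp add: e_def abs_mult abs_sgn_eq)
    have e2: "e * (of_int (a t) * z (u t)) \<ge> \<bar>z (u t)\<bar>" if u: "increasing_tuple k J u" for u
    proof -
      have "e * (of_int (a t) * z (u t)) = (of_int (a t) * sgn (of_int (a t))) * (s * z (u t))"
        by (simp add: e_def)
      also have "\<dots> = \<bar>of_int (a t)\<bar> * \<bar>z (u t)\<bar>"
        using s(2)[OF in_J[OF u tk(1)]] by (simp only: abs_sgn[symmetric])
      also have "\<dots> \<ge> 1 * \<bar>z (u t)\<bar>" using tk(2) by (intro mult_right_mono) linarith+
      finally show ?thesis by simp
    qed
    have "real D / 2 \<le> e * (h + f u)" if "increasing_tuple k J u" for u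
      using main[OF that e1 e2[OF that]] .
    moreover have "e = 1 \<or> e = -1" using e1 by linarith
    ultimately show ?thesis unfolding f_def by fastforce
  next
    case large
    \<comment> \<open>Here the sum is at most \<open>|h| / 2\<close>, and
      \<open>|h| >= D * |z (u t)| >= D\<close> leaves room for \<open>D / 2\<close>.\<close>
    have bound: "\<bar>f u\<bar> + real D / 2 \<le> \<bar>h\<bar>" if u: "increasing_tuple k J u" for u
    proof -
      have zt: "real D \<le> \<bar>z (u t)\<bar>" "real D * \<bar>z (u t)\<bar> \<le> \<bar>h\<bar>"
        using big large in_J[OF u tk(1)] by auto
      have zj: "\<bar>of_int (a j) * z (u j)\<bar> \<le> real d * (\<bar>h\<bar> / real D)" if "j < k" for j
        unfolding abs_mult using ad[OF that] large in_J[OF u that] D1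
        by (intro mult_mono) (auto simp: field_simps)
      have "\<bar>f u\<bar> \<le> (\<Sum>j<k. \<bar>of_int (a j) * z (u j)\<bar>)" unfolding f_def by (rule sum_abs)
      also have "\<dots> \<le> (\<Sum>j<k. real d * (\<bar>h\<bar> / real D))" by (intro sum_mono zj) auto
      also have "\<dots> = real k * real d * (\<bar>h\<bar> / real D)" by simp
      also have "\<dots> \<le> (real D / 2) * (\<bar>h\<bar> / real D)" using kd by (intro mult_right_mono) auto
      also have "\<dots> = \<bar>h\<bar> / 2" using D1 by simp
      finally have "\<bar>f u\<bar> \<le> \<bar>h\<bar> / 2" .
      moreover have "real D * 1 \<le> real D * \<bar>z (u t)\<bar>" using zt(1) D1 by (intro mult_left_mono) auto
      ultimately show ?thesis using zt(2) by linarith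
    qed
    show ?thesis
    proof (cases "h \<ge> 0")
      case True
      then show ?thesis using bound unfolding f_def by fastforce
    next
      case False
      then show ?thesis using bound unfolding f_def by fastforce
    qed
  qed
qed

section \<open>Signs of polynomials on exponentials of a spread sequence\<close>

text \<open>Exponent vectors of distinct terms differ by a nonzero integer vector, so the log-ratio
  of two nonzero terms has size at least \<open>D / 2\<close> and a sign common to all tuples. The
  term largest at one tuple is thus largest at all, by a factor of at least
  \<open>exp (D / 2) > card B\<close>, and its coefficient decides the sign.\<close>

lemma exp_sum_sgn_constant:
  fixes c :: "(nat \<Rightarrow> nat) \<Rightarrow> real" and k d :: nat
  defines "B \<equiv> PiE {..<k} (\<lambda>_. {..d})"
  assumes sp: "spread D J z"
    and D: "2 * (k * d + 1) + 2 * card B \<le> D"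
    and av: "\<And>\<alpha> \<beta>. \<alpha> \<in> B \<Longrightarrow> \<beta> \<in> B \<Longrightarrow> avoids D J z (abs (ln (abs (c \<alpha>)) - ln (abs (c \<beta>))))"
  shows "\<exists>s. \<forall>u. increasing_tuple k J u \<longrightarrow>
           sgn (\<Sum>\<beta>\<in>B. c \<beta> * exp (\<Sum>j<k. real (\<beta> j) * z (u j))) = s"
proof -
  have finB: "finite B" unfolding B_def by (intro finite_PiE) auto
  \<comment> \<open>Terms with zero coefficient are discarded before logarithms of coefficients are
    compared.\<close>
  define B' where "B' = {\<beta> \<in> B. c \<beta> \<noteq> 0}"
  have B': "finite B'" "B' \<subseteq> B" "\<And>\<beta>. \<beta> \<in> B' \<Longrightarrow> c \<beta> \<noteq> 0" using finB by (auto simp: B'_def)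
  have sumB': "(\<Sum>\<beta>\<in>B. c \<beta> * g \<beta>) = (\<Sum>\<beta>\<in>B'. c \<beta> * g \<beta>)" for g
    using finB by (intro sum.mono_neutral_right) (auto simp: B'_def)
  show ?thesis
  proof (cases "B' = {} \<or> (\<forall>u. \<not> increasing_tuple k J u)")
    case True
    then show ?thesis unfolding sumB' by auto
  next
    case False
    then obtain u0 where u0: "increasing_tuple k J u0" and ne: "B' \<noteq> {}" by blast
    define L where "L \<beta> u = ln (abs (c \<beta>)) + (\<Sum>j<k. real (\<beta> j) * z (u j))" for \<beta> u
    obtain \<alpha> where \<alpha>: "\<alpha> \<in> B'" "\<And>\<beta>. \<beta> \<in> B' \<Longrightarrow> L \<beta> u0 \<le> L \<alpha> u0"
    proof -
      have "Max ((\<lambda>\<beta>. L \<beta> u0) ` B') \<in> (\<lambda>\<beta>. L \<beta> u0) ` B'" using B'(1) ne by (intro Max_in) auto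
      then obtain \<alpha> where "\<alpha> \<in> B'" "L \<alpha> u0 = Max ((\<lambda>\<beta>. L \<beta> u0) ` B')" by auto
      then show thesis using that B'(1) by auto
    qed
    have gap: "real D / 2 \<le> L \<alpha> u - L \<beta> u"
      if \<beta>: "\<beta> \<in> B'" "\<beta> \<noteq> \<alpha>" and u: "increasing_tuple k J u" for \<beta> u
    proof -
      have mem: "\<alpha> \<in> B" "\<beta> \<in> B" using \<alpha> \<beta> B' by auto
      have bounded: "\<bar>int (\<alpha> j) - int (\<beta> j)\<bar> \<le> int d" if "j < k" for j
      proof -
        have "\<alpha> j \<le> d" "\<beta> j \<le> d" using mem that unfolding B_def by auto
        then show ?thesis by linarith
      qed
      \<comment> \<open>Members of \<open>B\<close> agree outside \<open>{..<k}\<close>, so distinct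
        ones differ at some \<open>j < k\<close>.\<close>
      have differ: "\<exists>j<k. int (\<alpha> j) - int (\<beta> j) \<noteq> 0"
        using \<beta>(2) mem PiE_ext[of \<alpha> "{..<k}" "\<lambda>_. {..d}" \<beta>] unfolding B_def by force
      have large: "2 * (k * d + 1) \<le> D" using D by (rule add_leD1)
      have L_diff: "(ln (abs (c \<alpha>)) - ln (abs (c \<beta>))) + (\<Sum>j<k. of_int (int (\<alpha> j) - int (\<beta> j)) * z (u j))
          = L \<alpha> u - L \<beta> u" for u
        unfolding L_def by (simp add: left_diff_distrib sum_subtractf)
      consider "\<forall>u. increasing_tuple k J u \<longrightarrow> L \<alpha> u - L \<beta> u \<ge> real D / 2"
        | "\<forall>u. increasing_tuple k J u \<longrightarrow> L \<alpha> u - L \<beta> u \<le> - (real D / 2)"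
        using log_ratio_sign[where a = "\<lambda>j. int (\<alpha> j) - int (\<beta> j)", OF sp av[OF mem] large bounded differ]
        unfolding L_diff by blast
      then show ?thesis
      proof cases
        case 1 then show ?thesis using u by blast
      next
        \<comment> \<open>This sign contradicts the maximality of \<alpha> at the reference tuple
          \<open>u0\<close>.\<close>
        case 2
        then have "L \<alpha> u0 - L \<beta> u0 \<le> - (real D / 2)" using u0 by blast
        moreover have "real D > 0" using D by (cases D) auto
        ultimately show ?thesis using \<alpha>(2)[OF \<beta>(1)] by linarith
      qed
    qed
    have abs_term: "\<bar>c \<beta> * exp (\<Sum>j<k. real (\<beta> j) * z (u j))\<bar> = exp (L \<beta> u)" if "\<beta> \<in> B'" for \<beta> u
      using B'(3)[OF that] by (simp add: L_def exp_add abs_mult)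
    have "sgn (\<Sum>\<beta>\<in>B. c \<beta> * exp (\<Sum>j<k. real (\<beta> j) * z (u j))) = sgn (c \<alpha>)"
      if u: "increasing_tuple k J u" for u
    proof -
      define t where "t \<beta> = c \<beta> * exp (\<Sum>j<k. real (\<beta> j) * z (u j))" for \<beta>
      have "\<bar>\<Sum>\<beta>\<in>B'-{\<alpha>}. t \<beta>\<bar> \<le> (\<Sum>\<beta>\<in>B'-{\<alpha>}. \<bar>t \<beta>\<bar>)" by (rule sum_abs)
      also have "\<dots> \<le> (\<Sum>\<beta>\<in>B'-{\<alpha>}. exp (L \<alpha> u - real D / 2))"
      proof (rule sum_mono)
        fix \<beta> assume "\<beta> \<in> B' - {\<alpha>}"
        then show "\<bar>t \<beta>\<bar> \<le> exp (L \<alpha> u - real D / 2)"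
          using gap[of \<beta> u] u by (simp add: t_def abs_term)
      qed
      also have "\<dots> = real (card (B' - {\<alpha>})) * exp (L \<alpha> u - real D / 2)" by simp
      also have "\<dots> < exp (real D / 2) * exp (L \<alpha> u - real D / 2)"
      proof (rule mult_strict_right_mono)
        have "card (B' - {\<alpha>}) \<le> card B" using finB B'(2) by (intro card_mono) auto
        moreover have "2 * card B \<le> D" using D by (rule add_leD2)
        moreover have "1 + real D / 2 \<le> exp (real D / 2)" by (rule exp_ge_add_one_self)
        ultimately show "real (card (B' - {\<alpha>})) < exp (real D / 2)" by linarith
      qed simp
      also have "\<dots> = \<bar>t \<alpha>\<bar>" using \<alpha>(1) by (simp add: t_def abs_term flip: exp_add)
      finally have less: "\<bar>\<Sum>\<beta>\<in>B'-{\<alpha>}. t \<beta>\<bar> < \<bar>t \<alpha>\<bar>" .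
      have "(\<Sum>\<beta>\<in>B. t \<beta>) = t \<alpha> + (\<Sum>\<beta>\<in>B'-{\<alpha>}. t \<beta>)"
        unfolding t_def sumB' using \<alpha>(1) B'(1) by (subst sum.remove[of _ \<alpha>]) auto
      then have "sgn (\<Sum>\<beta>\<in>B. t \<beta>) = sgn (t \<alpha>)"
        using less by (auto simp: sgn_if abs_if split: if_splits)
      also have "\<dots> = sgn (c \<alpha>)" by (simp add: t_def sgn_mult)
      finally show ?thesis unfolding t_def .
    qed
    then show ?thesis by blast
  qed
qed

text \<open>The binomial theorem turns each monomial into a sum of exponentials. The order of
  quantifiers is the point: \<open>d\<close> depends on \<open>p\<close> only, so the required
  spread can be fixed before \<open>a\<close>, \<open>r\<close> and the sequence are known, and
  \<open>c\<close> depends on \<open>a\<close> and \<open>r\<close> but not on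
  \<open>z\<close>.\<close>

lemma mpoly_eval_affine_exp:
  assumes vars: "mpoly_vars p \<subseteq> {..<k}"
  shows "\<exists>d. \<forall>a r. \<exists>c. \<forall>z x. (\<forall>j<k. x j = a + r * exp (z j)) \<longrightarrow>
     mpoly_eval p x = (\<Sum>\<beta>\<in>PiE {..<k} (\<lambda>_. {..d}). c \<beta> * exp (\<Sum>j<k. real (\<beta> j) * z j))"
proof -
  let ?l = "Poly_Mapping.lookup" and ?K = "Poly_Mapping.keys p"
  have keys: "Poly_Mapping.keys m \<subseteq> {..<k}" if "m \<in> ?K" for m
    using vars that unfolding mpoly_vars_def by blast
  have "finite (\<Union>m\<in>?K. ?l m ` Poly_Mapping.keys m)" by auto
  then obtain d where "\<forall>e\<in>(\<Union>m\<in>?K. ?l m ` Poly_Mapping.keys m). e \<le> d"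
    unfolding finite_nat_set_iff_bounded_le by blast
  then have d: "?l m j \<le> d" if "m \<in> ?K" for m j
    using that by (cases "j \<in> Poly_Mapping.keys m") (auto simp: in_keys_iff)
  show ?thesis
  proof (intro exI[of _ d] allI)
    fix a r :: real
    define q where "q e b = real (e choose b) * r ^ b * a ^ (e - b)" for e b
    define c where "c \<beta> = (\<Sum>m\<in>?K. of_rat (?l p m) * (\<Prod>j<k. q (?l m j) (\<beta> j)))" for \<beta>
    have "mpoly_eval p x = (\<Sum>\<beta>\<in>PiE {..<k} (\<lambda>_. {..d}). c \<beta> * exp (\<Sum>j<k. real (\<beta> j) * z j))"
      if x: "\<forall>j<k. x j = a + r * exp (z j)" for z x
    proof -
      have pow: "(a + r * exp y) ^ e = (\<Sum>b\<le>d. q e b * exp (real b * y))" if "e \<le> d" for e y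
      proof -
        have "(a + r * exp y) ^ e = (\<Sum>b\<le>e. q e b * exp (real b * y))"
          unfolding add.commute[of a] binomial_ring exp_of_nat_mult
          by (intro sum.cong) (auto simp: q_def power_mult_distrib mult_ac)
        \<comment> \<open>All powers get the common range \<open>{..d}\<close>, since
          \<open>e choose b = 0\<close> for \<open>b > e\<close>.\<close>
        also have "\<dots> = (\<Sum>b\<le>d. q e b * exp (real b * y))"
          using that by (intro sum.mono_neutral_left) (auto simp: q_def)
        finally show ?thesis .
      qed
      have mon: "(\<Prod>i\<in>Poly_Mapping.keys m. x i ^ ?l m i)
          = (\<Sum>\<beta>\<in>PiE {..<k} (\<lambda>_. {..d}). (\<Prod>j<k. q (?l m j) (\<beta> j)) * exp (\<Sum>j<k. real (\<beta> j) * z j))"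
        if m: "m \<in> ?K" for m
      proof -
        have "(\<Prod>i\<in>Poly_Mapping.keys m. x i ^ ?l m i) = (\<Prod>j<k. x j ^ ?l m j)"
          using keys[OF m] by (intro prod.mono_neutral_left) (auto simp: in_keys_iff)
        also have "\<dots> = (\<Prod>j<k. \<Sum>b\<le>d. q (?l m j) b * exp (real b * z j))"
          using x pow[OF d[OF m]] by (intro prod.cong) auto
        also have "\<dots> = (\<Sum>\<beta>\<in>PiE {..<k} (\<lambda>_. {..d}). \<Prod>j<k. q (?l m j) (\<beta> j) * exp (real (\<beta> j) * z j))"
          by (intro prod_sum_PiE) auto
        finally show ?thesis by (simp add: prod.distrib exp_sum)
      qed
      have "mpoly_eval p x = (\<Sum>m\<in>?K. \<Sum>\<beta>\<in>PiE {..<k} (\<lambda>_. {..d}).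
          of_rat (?l p m) * ((\<Prod>j<k. q (?l m j) (\<beta> j)) * exp (\<Sum>j<k. real (\<beta> j) * z j)))"
        unfolding mpoly_eval_def by (intro sum.cong) (auto simp: mon sum_distrib_left)
      also have "\<dots> = (\<Sum>\<beta>\<in>PiE {..<k} (\<lambda>_. {..d}). c \<beta> * exp (\<Sum>j<k. real (\<beta> j) * z j))"
        unfolding c_def sum_distrib_right by (subst sum.swap) (simp add: mult.assoc)
      finally show ?thesis .
    qed
    then show "\<exists>c. \<forall>z x. (\<forall>j<k. x j = a + r * exp (z j)) \<longrightarrow>
     mpoly_eval p x = (\<Sum>\<beta>\<in>PiE {..<k} (\<lambda>_. {..d}). c \<beta> * exp (\<Sum>j<k. real (\<beta> j) * z j))" by blast
  qed
qed

section \<open>Thinning a spread sequence until polynomial signs are constant\<close>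

definition homogeneous :: "nat \<Rightarrow> rat_mpoly \<Rightarrow> (nat \<Rightarrow> real) \<Rightarrow> nat set \<Rightarrow> bool" where
  "homogeneous k p x J \<longleftrightarrow> (\<exists>s. \<forall>u. increasing_tuple k J u \<longrightarrow> sgn (mpoly_eval p (\<lambda>j. x (u j))) = s)"

lemma homogeneous_subset: "homogeneous k p x J \<Longrightarrow> K \<subseteq> J \<Longrightarrow> homogeneous k p x K"
  unfolding homogeneous_def increasing_tuple_def by (meson subset_trans)

text \<open>Each pair of exponent vectors yields one log-ratio of coefficients to be avoided, at the
  cost of a factor 3. Only these thresholds vary with \<open>a\<close> and \<open>r\<close>, not
  their number, so \<open>D0\<close> and \<open>W\<close> can be chosen uniformly.\<close>

lemma spread_ex_homogeneous_single:
  assumes "mpoly_vars p \<subseteq> {..<k}"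
  shows "\<exists>D0 W. \<forall>D J z a r n. D0 \<le> D \<longrightarrow> spread D J z \<longrightarrow> finite J \<longrightarrow> W * n \<le> card J \<longrightarrow> 3 \<le> n \<longrightarrow>
     (\<exists>K\<subseteq>J. n \<le> card K \<and> homogeneous k p (\<lambda>i. a + r * exp (z i)) K)"
proof -
  obtain d where d: "\<And>a r. \<exists>c. \<forall>z x. (\<forall>j<k. x j = a + r * exp (z j)) \<longrightarrow>
     mpoly_eval p x = (\<Sum>\<beta>\<in>PiE {..<k} (\<lambda>_. {..d}). c \<beta> * exp (\<Sum>j<k. real (\<beta> j) * z j))"
    using mpoly_eval_affine_exp[OF assms] by blast
  define B :: "(nat \<Rightarrow> nat) set" where "B = PiE {..<k} (\<lambda>_. {..d})"
  have finB: "finite B" unfolding B_def by (intro finite_PiE) auto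
  show ?thesis
  proof (rule exI[of _ "2 * (k * d + 1) + 2 * card B"], rule exI[of _ "3 ^ card (B \<times> B)"],
      intro allI impI)
    fix D J z n and a r :: real
    assume D: "2 * (k * d + 1) + 2 * card B \<le> D" and sp: "spread D J z" and fin: "finite J"
      and card: "3 ^ card (B \<times> B) * n \<le> card J" and n: "3 \<le> n"
    obtain c where c: "\<And>z x. (\<forall>j<k. x j = a + r * exp (z j)) \<Longrightarrow>
      mpoly_eval p x = (\<Sum>\<beta>\<in>B. c \<beta> * exp (\<Sum>j<k. real (\<beta> j) * z j))"
      using d[of a r] unfolding B_def by blast
    define H where "H = (\<lambda>(\<alpha>,\<beta>). (abs (ln (abs (c \<alpha>)) - ln (abs (c \<beta>))))) ` (B \<times> B)"
    have finH: "finite H" using finB by (simp add: H_def)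
    have "(3::nat) ^ card H \<le> 3 ^ card (B \<times> B)"
      unfolding H_def using finB by (intro power_increasing card_image_le) auto
    then have "3 ^ card H * n \<le> card J" using card by (meson le_trans mult_le_mono1)
    moreover have "2 \<le> D" using D by simp
    ultimately obtain K where K: "K \<subseteq> J" "n \<le> card K" "\<forall>h\<in>H. avoids D K z h"
      using spread_ex_avoids[OF finH sp fin] n by blast
    have "avoids D K z (abs (ln (abs (c \<alpha>)) - ln (abs (c \<beta>))))" if "\<alpha> \<in> B" "\<beta> \<in> B" for \<alpha> \<beta>
      using K(3) that unfolding H_def by auto
    then obtain s where s: "\<And>u. increasing_tuple k K u \<Longrightarrow>
        sgn (\<Sum>\<beta>\<in>B. c \<beta> * exp (\<Sum>j<k. real (\<beta> j) * z (u j))) = s"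
      using exp_sum_sgn_constant[OF spread_subset[OF sp K(1)], of k d c] D unfolding B_def by blast
    have "homogeneous k p (\<lambda>i. a + r * exp (z i)) K"
      unfolding homogeneous_def
    proof (intro exI allI impI)
      fix u assume u: "increasing_tuple k K u"
      show "sgn (mpoly_eval p (\<lambda>j. a + r * exp (z (u j)))) = s"
        using s[OF u] c[of "\<lambda>j. a + r * exp (z (u j))" "\<lambda>j. z (u j)"] by simp
    qed
    then show "\<exists>K\<subseteq>J. n \<le> card K \<and> homogeneous k p (\<lambda>i. a + r * exp (z i)) K" using K by blast
  qed
qed

lemma spread_ex_homogeneous:
  assumes "finite A" "\<And>k p. (k, p) \<in> A \<Longrightarrow> mpoly_vars p \<subseteq> {..<k}"
  shows "\<exists>D0 W. W \<ge> 1 \<and> (\<forall>D J z a r n. D0 \<le> D \<longrightarrow> spread D J z \<longrightarrow> finite J \<longrightarrow> W * n \<le> card J \<longrightarrow> 3 \<le> n \<longrightarrow>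
     (\<exists>K\<subseteq>J. n \<le> card K \<and> (\<forall>(k, p)\<in>A. homogeneous k p (\<lambda>i. a + r * exp (z i)) K)))"
  using assms
proof (induction A rule: finite_induct)
  case empty
  show ?case by (intro exI[of _ 0] exI[of _ 1]) auto
next
  case (insert kp A)
  obtain k p where kp: "kp = (k, p)" by fastforce
  obtain D0 W where W: "W \<ge> 1" and IH: "\<And>D J z a r n. D0 \<le> D \<Longrightarrow> spread D J z \<Longrightarrow> finite J \<Longrightarrow>
      W * n \<le> card J \<Longrightarrow> 3 \<le> n \<Longrightarrow>
      \<exists>K\<subseteq>J. n \<le> card K \<and> (\<forall>(k, p)\<in>A. homogeneous k p (\<lambda>i. a + r * exp (z i)) K)"
    using insert.IH insert.prems by (metis insertI2)
  obtain D1 V where V: "\<And>D J z a r n. D1 \<le> D \<Longrightarrow> spread D J z \<Longrightarrow> finite J \<Longrightarrow>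
      V * n \<le> card J \<Longrightarrow> 3 \<le> n \<Longrightarrow>
      \<exists>K\<subseteq>J. n \<le> card K \<and> homogeneous k p (\<lambda>i. a + r * exp (z i)) K"
    using spread_ex_homogeneous_single[of p k] insert.prems kp by (metis insertI1)
  show ?case
  \<comment> \<open>The losses multiply. \<open>Suc V\<close> replaces \<open>V\<close>, which might
    be 0, to keep the new constant positive.\<close>
  proof (rule exI[of _ "max D0 D1"], rule exI[of _ "Suc V * W"], intro conjI allI impI)
    show "1 \<le> Suc V * W" using W by simp
    fix D J z n and a r :: real
    assume *: "max D0 D1 \<le> D" "spread D J z" "finite J" "Suc V * W * n \<le> card J" "3 \<le> n"
    have "W * n \<ge> 1 * 3" using W *(5) by (intro mult_le_mono) auto
    moreover have "V * (W * n) \<le> card J" using *(4) by (simp add: algebra_simps)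
    ultimately obtain K where K: "K \<subseteq> J" "W * n \<le> card K" "homogeneous k p (\<lambda>i. a + r * exp (z i)) K"
      using V[of D J z "W * n" a r] *(1-3) by auto
    have "finite K" "spread D K z"
      using finite_subset[OF K(1) *(3)] spread_subset[OF *(2) K(1)] .
    then obtain M where M: "M \<subseteq> K" "n \<le> card M" "\<forall>(k, p)\<in>A. homogeneous k p (\<lambda>i. a + r * exp (z i)) M"
      using IH[of D K z n a r] K(2) *(1,5) by auto
    have "M \<subseteq> J" using M(1) K(1) by blast
    then show "\<exists>K\<subseteq>J. n \<le> card K \<and> (\<forall>(k, p)\<in>insert kp A. homogeneous k p (\<lambda>i. a + r * exp (z i)) K)"
      using M(2,3) homogeneous_subset[OF K(3) M(1)] unfolding kp
      by (intro exI[of _ M] conjI) simp_all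
  qed
qed

section \<open>Subsequences of affine exponential form\<close>

lemma ex_constant_sign:
  fixes z :: "nat \<Rightarrow> real"
  assumes "finite I" "2 * m \<le> card I" "\<And>i. i \<in> I \<Longrightarrow> z i \<noteq> 0"
  shows "\<exists>J\<subseteq>I. m \<le> card J \<and> ((\<forall>i\<in>J. z i > 0) \<or> (\<forall>i\<in>J. z i < 0))"
proof -
  have "\<exists>c\<in>{True, False}. m \<le> card {i \<in> I. (z i > 0) = c}"
    using assms(1,2) by (intro ex_large_fibre) auto
  then obtain c where c: "m \<le> card {i \<in> I. (z i > 0) = c}" by blast
  have "z i < 0" if "i \<in> I" "\<not> z i > 0" for i using assms(3)[OF that(1)] that(2) by simp
  then show ?thesis using c by (intro exI[of _ "{i \<in> I. (z i > 0) = c}"]) (cases c; auto)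
qed

lemma separated_imp_ln_gap:
  assumes "separated E I z" "real D \<le> ln (real E)" "E \<ge> 1" "i \<in> I" "j \<in> I" "i \<noteq> j" "z i \<noteq> 0" "z j \<noteq> 0"
  shows "real D \<le> \<bar>ln \<bar>z i\<bar> - ln \<bar>z j\<bar>\<bar>"
proof -
  have *: "real D + ln \<bar>u\<bar> \<le> ln \<bar>v\<bar>" if "real E * \<bar>u\<bar> \<le> \<bar>v\<bar>" "u \<noteq> 0" "v \<noteq> 0" for u v :: real
  proof -
    have "ln (real E) + ln \<bar>u\<bar> = ln (real E * \<bar>u\<bar>)" using assms(3) that by (simp add: ln_mult)
    also have "\<dots> \<le> ln \<bar>v\<bar>" using that assms(3) by simp
    finally show ?thesis using assms(2) by simp
  qed
  from assms(1,4-6) have "real E * \<bar>z i\<bar> \<le> \<bar>z j\<bar> \<or> real E * \<bar>z j\<bar> \<le> \<bar>z i\<bar>"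
    unfolding separated_def by blast
  then show ?thesis using *[of "z i" "z j"] *[of "z j" "z i"] assms(7,8) by auto
qed

text \<open>The second separation, applied to the logarithms \<open>y\<close>. Once all
  \<open>y i - q\<close> have the same sign, the distances \<open>|y i - q|\<close> are monotone in
  the index because \<open>y\<close> is, and the gaps make them at least \<open>D\<close>. Asking
  for \<open>2 * n\<close> separated points pays for the constant sign.\<close>

lemma monotone_separated_ex_spread:
  fixes y :: "nat \<Rightarrow> real"
  assumes fin: "finite I" and D: "D \<ge> 1" and card: "(2 * D + 1) ^ (2 * n) \<le> card I"
    and gap: "\<And>i j. i \<in> I \<Longrightarrow> j \<in> I \<Longrightarrow> i \<noteq> j \<Longrightarrow> real D \<le> \<bar>y i - y j\<bar>"
    and mono: "(\<forall>i\<in>I. \<forall>j\<in>I. i < j \<longrightarrow> y i < y j) \<or> (\<forall>i\<in>I. \<forall>j\<in>I. i < j \<longrightarrow> y j < y i)"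
  shows "\<exists>q. \<exists>J\<subseteq>I. n \<le> card J \<and> spread D J (\<lambda>i. y i - q)"
proof -
  have D0: "real D > 0" using D by simp
  have inj: "inj_on y I"
  proof (rule inj_onI, rule ccontr)
    fix i j assume "i \<in> I" "j \<in> I" "y i = y j" "i \<noteq> j"
    then show False using gap[of i j] D0 by simp
  qed
  obtain q J where q: "q \<in> I" and J: "J \<subseteq> I - {q}" "card J = 2 * n"
    and sep: "separated D J (\<lambda>i. y i - y q)"
    using ex_separated[OF fin inj D card] by blast
  have far: "real D \<le> \<bar>y i - y q\<bar>" if "i \<in> J" for i using gap[of i q] that q J by blast
  then have "y i - y q \<noteq> 0" if "i \<in> J" for i using that D0 by force
  moreover have "finite J" using J(1) fin finite_subset by blast
  ultimately obtain K where K: "K \<subseteq> J" "n \<le> card K"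
    and sgn: "(\<forall>i\<in>K. y i - y q > 0) \<or> (\<forall>i\<in>K. y i - y q < 0)"
    using ex_constant_sign[of J n "\<lambda>i. y i - y q"] J by auto
  have KI: "i \<in> I" if "i \<in> K" for i using that K(1) J(1) by blast
  \<comment> \<open>As \<open>D >= 1\<close>, separation can only hold in the direction given by the
    strict inequality.\<close>
  have sepK: "real D * \<bar>y i - y q\<bar> \<le> \<bar>y j - y q\<bar>" if "i \<in> K" "j \<in> K" "\<bar>y i - y q\<bar> < \<bar>y j - y q\<bar>" for i j
  proof -
    have "real D * \<bar>y i - y q\<bar> \<le> \<bar>y j - y q\<bar> \<or> real D * \<bar>y j - y q\<bar> \<le> \<bar>y i - y q\<bar>"
      using sep that K(1) unfolding separated_def by (metis order_less_irrefl subsetD)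
    moreover have "1 * \<bar>y j - y q\<bar> \<le> real D * \<bar>y j - y q\<bar>" using D by (intro mult_right_mono) auto
    ultimately show ?thesis using that(3) by (elim disjE; linarith)
  qed
  have ord: "(\<forall>i\<in>K. \<forall>j\<in>K. i < j \<longrightarrow> \<bar>y i - y q\<bar> < \<bar>y j - y q\<bar>) \<or>
        (\<forall>i\<in>K. \<forall>j\<in>K. i < j \<longrightarrow> \<bar>y j - y q\<bar> < \<bar>y i - y q\<bar>)"
    using sgn
  proof
    assume "\<forall>i\<in>K. y i - y q > 0"
    then have "\<bar>y i - y q\<bar> = y i - y q" if "i \<in> K" for i using that by force
    then show ?thesis using mono by (auto simp: KI)
  next
    assume "\<forall>i\<in>K. y i - y q < 0"
    then have "\<bar>y i - y q\<bar> = y q - y i" if "i \<in> K" for i using that by force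
    then show ?thesis using mono by (auto simp: KI)
  qed
  have "(\<forall>i\<in>K. real D \<le> y i - y q) \<or> (\<forall>i\<in>K. y i - y q \<le> - real D)"
    using sgn
  proof
    assume "\<forall>i\<in>K. y i - y q > 0"
    then have "real D \<le> y i - y q" if "i \<in> K" for i using far[of i] that K(1) by force
    then show ?thesis by blast
  next
    assume "\<forall>i\<in>K. y i - y q < 0"
    then have "y i - y q \<le> - real D" if "i \<in> K" for i using far[of i] that K(1) by force
    then show ?thesis by blast
  qed
  then have "spread D K (\<lambda>i. y i - y q)"
    unfolding spread_def using ord sepK by blast
  moreover have "K \<subseteq> I" using K(1) J(1) by blast
  ultimately show ?thesis using K(2) by blast
qed

text \<open>With many repetitions a constant subsequence suffices. Otherwise distances to a point
  \<open>p\<close>, separated by a factor \<open>3 ^ D\<close>, have logarithms \<open>y\<close>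
  with gaps at least \<open>D\<close>; recentring a monotone part of \<open>y\<close> at
  \<open>q\<close> gives \<open>z = y - q\<close> and \<open>r = s * exp q\<close>, where
  \<open>s\<close> is 1 or -1. In \<open>M D n\<close>, the factor 2 pays for the sign of
  \<open>x i - x p\<close>, the square for monotonicity and the power for the second
  separation.\<close>

lemma ex_affine_exp_spread:
  fixes x :: "nat \<Rightarrow> real"
  defines "M \<equiv> \<lambda>D n. 2 * ((2 * D + 1) ^ (2 * n) * (2 * D + 1) ^ (2 * n))"
  assumes fin: "finite I" and D: "D \<ge> 1" and n: "n \<ge> 1"
    and card: "n * (2 * 3 ^ D + 1) ^ M D n \<le> card I"
  shows "\<exists>J\<subseteq>I. n \<le> card J \<and> (\<exists>z a r. spread D J z \<and> (\<forall>i\<in>J. x i = a + r * exp (z i)))"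
proof (cases "card (x ` I) * n \<le> card I")
  case True
  have "0 < n * (2 * 3 ^ D + 1) ^ M D n" using n by simp
  then have "I \<noteq> {}" using card by auto
  then obtain v where v: "n \<le> card {i \<in> I. x i = v}"
    using ex_large_fibre[OF fin, of "x ` I" x n] fin True by auto
  \<comment> \<open>Any spread sequence will do; the exponent \<open>Suc i\<close> makes even its
    value at index 0 at least \<open>D\<close>.\<close>
  define z where "z i = real D ^ Suc i" for i
  have "spread D {i \<in> I. x i = v} z"
  proof -
    have "real D \<le> z i" for i using D by (simp add: z_def mult_le_cancel_left1)
    moreover have "real D * \<bar>z i\<bar> \<le> \<bar>z j\<bar>" if "i < j" for i j
    proof -
      have "real D ^ Suc (Suc i) \<le> real D ^ Suc j" using that D by (intro power_increasing) auto
      then show ?thesis by (simp add: z_def)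
    qed
    ultimately show ?thesis unfolding spread_def by blast
  qed
  (* a constant sequence has the required form with r = 0 *)
  then show ?thesis using v
    by (intro exI[of _ "{i \<in> I. x i = v}"] conjI exI[of _ z] exI[of _ v] exI[of _ 0]) auto
next
  case False
  \<comment> \<open>A factor \<open>3 ^ D\<close> between distances is a gap of at least
    \<open>D\<close> between logarithms, since \<open>ln 3 >= 1\<close>.\<close>
  define E :: nat where "E = 3 ^ D"
  define R where "R = (2 * D + 1) ^ (2 * n)"
  have "n * (2 * E + 1) ^ M D n < card (x ` I) * n" using False card unfolding E_def by linarith
  then have large: "(2 * E + 1) ^ M D n \<le> card (x ` I)" by (simp add: mult.commute)
  obtain I0 where I0: "I0 \<subseteq> I" "inj_on x I0" "x ` I = x ` I0"
    using subset_image_inj[of "x ` I" x I] by auto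
  have "finite I0" using I0(1) fin finite_subset by blast
  moreover have "E \<ge> 1" by (simp add: E_def)
  moreover have "(2 * E + 1) ^ M D n \<le> card I0" using large I0 by (simp add: card_image)
  ultimately obtain p I1 where p: "p \<in> I0" and I1: "I1 \<subseteq> I0 - {p}" "card I1 = M D n"
    and sep: "separated E I1 (\<lambda>i. x i - x p)"
    using ex_separated[of I0 x E "M D n"] I0(2) by blast
  have nz: "x i - x p \<noteq> 0" if "i \<in> I1" for i
    using that I1 I0(2) p by (auto dest: inj_onD)
  have finI1: "finite I1" using I1 \<open>finite I0\<close> finite_subset by blast
  obtain I2 where I2: "I2 \<subseteq> I1" "R * R \<le> card I2"
    and sgn: "(\<forall>i\<in>I2. x i - x p > 0) \<or> (\<forall>i\<in>I2. x i - x p < 0)"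
    using ex_constant_sign[OF finI1, of "R * R" "\<lambda>i. x i - x p"] I1(2) nz unfolding M_def R_def by auto
  define y where "y i = ln \<bar>x i - x p\<bar>" for i
  have lnE: "real D \<le> ln (real E)"
  proof -
    have "1 \<le> ln (3::real)" using exp_le by (simp add: ln_ge_iff)
    then have "real D * 1 \<le> real D * ln 3" by (intro mult_left_mono) auto
    then show ?thesis by (simp add: E_def ln_realpow)
  qed
  have gap: "real D \<le> \<bar>y i - y j\<bar>" if "i \<in> I2" "j \<in> I2" "i \<noteq> j" for i j
    unfolding y_def using that I2(1) nz
    by (intro separated_imp_ln_gap[OF sep lnE \<open>E \<ge> 1\<close>]) auto
  have "inj_on y I2"
  proof (rule inj_onI, rule ccontr)
    fix i j assume "i \<in> I2" "j \<in> I2" "y i = y j" "i \<noteq> j"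
    then show False using gap[of i j] D by simp
  qed
  have finI2: "finite I2" using I2 finI1 finite_subset by blast
  have R: "R \<ge> 1" by (simp add: R_def)
  then have "(R - 1) * (R - 1) < R * R" by (intro mult_strict_mono) auto
  then have "(R - 1) * (R - 1) < card I2" using I2(2) by simp
  then obtain I3 where I3: "I3 \<subseteq> I2" "card I3 = R"
    and mono: "(\<forall>i\<in>I3. \<forall>j\<in>I3. i < j \<longrightarrow> y i < y j) \<or> (\<forall>i\<in>I3. \<forall>j\<in>I3. i < j \<longrightarrow> y j < y i)"
    using erdos_szekeres_monotone[OF finI2 \<open>inj_on y I2\<close>, of "R - 1" "R - 1"] R by auto
  have finI3: "finite I3" using I3 finI2 finite_subset by blast
  have large3: "(2 * D + 1) ^ (2 * n) \<le> card I3" using I3(2) by (simp add: R_def)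
  have gap3: "real D \<le> \<bar>y i - y j\<bar>" if "i \<in> I3" "j \<in> I3" "i \<noteq> j" for i j
    using gap that I3(1) by blast
  obtain q J where J: "J \<subseteq> I3" "n \<le> card J" "spread D J (\<lambda>i. y i - q)"
    using monotone_separated_ex_spread[OF finI3 D large3 gap3 mono] by blast
  obtain s where s: "\<And>i. i \<in> I2 \<Longrightarrow> x i - x p = s * \<bar>x i - x p\<bar>"
    using sgn
  proof
    assume "\<forall>i\<in>I2. x i - x p > 0"
    then show thesis by (intro that[of 1]) auto
  next
    assume "\<forall>i\<in>I2. x i - x p < 0"
    then show thesis by (intro that[of "-1"]) auto
  qed
  have "x i = x p + s * exp q * exp (y i - q)" if "i \<in> J" for i
  proof -
    have i: "i \<in> I2" "i \<in> I1" using that J I3 I2 by auto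
    have "exp q * exp (y i - q) = \<bar>x i - x p\<bar>"
      using nz[OF i(2)] by (simp add: y_def flip: exp_add)
    then show ?thesis using s[OF i(1)] by (simp add: mult.assoc)
  qed
  moreover have "J \<subseteq> I" using J I3 I2 I1 I0 by blast
  ultimately show ?thesis using J(2,3) by blast
qed

section \<open>Arithmetic of the double exponential bound\<close>

lemma double_exponential_bound:
  "\<exists>C. \<forall>n\<ge>1. real ((w * n) * (2 * 3 ^ D + 1) ^
      (2 * ((2 * D + 1) ^ (2 * (w * n)) * (2 * D + 1) ^ (2 * (w * n))))) \<le> 2 powr (2 powr (C * real n))"
proof -
  define e g :: nat where "e = 2 * 3 ^ D + 1" and "g = 2 * D + 1"
  \<comment> \<open>The summands \<open>w\<close> and \<open>2 * e\<close> absorb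
    \<open>w * n + 2 * e\<close>, and \<open>4 * g * w\<close> absorbs
    \<open>g ^ (4 * (w * n))\<close>, as \<open>g <= 2 ^ g\<close>.\<close>
  define C where "C = w + 2 * e + 4 * g * w"
  have "real ((w * n) * e ^ (2 * (g ^ (2 * (w * n)) * g ^ (2 * (w * n))))) \<le> 2 powr (2 powr (real C * real n))"
    if n: "n \<ge> 1" for n
  proof -
    have e2: "e \<le> 2 ^ e" and g2: "g \<le> 2 ^ g" by (simp_all add: less_exp less_imp_le)
    define G where "G = g ^ (4 * (w * n))"
    have G: "G = g ^ (2 * (w * n)) * g ^ (2 * (w * n))" "G \<ge> 1"
    proof -
      have "4 * (w * n) = 2 * (w * n) + 2 * (w * n)" by simp
      then show "G = g ^ (2 * (w * n)) * g ^ (2 * (w * n))" unfolding G_def by (simp only: power_add)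
      show "G \<ge> 1" by (simp add: G_def g_def)
    qed
    have "w * n * e ^ (2 * G) \<le> 2 ^ (w * n) * (2 ^ e) ^ (2 * G)"
      using e2 by (intro mult_le_mono power_mono) (simp_all add: less_exp less_imp_le)
    also have "\<dots> = 2 ^ (w * n + 2 * e * G)" by (simp add: power_add mult_ac flip: power_mult)
    also have "\<dots> \<le> 2 ^ ((w * n + 2 * e) * G)"
      using G(2) by (intro power_increasing) (auto simp: algebra_simps)
    also have "\<dots> \<le> 2 ^ (2 ^ (C * n))"
    proof (rule power_increasing)
      have "w * n + 2 * e \<le> 2 ^ (w * n + 2 * e)" by (simp add: less_exp less_imp_le)
      also have "\<dots> \<le> 2 ^ (w * n + 2 * e * n)" using n by (intro power_increasing) auto
      finally have "w * n + 2 * e \<le> 2 ^ (w * n + 2 * e * n)" .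
      moreover have "G \<le> (2 ^ g) ^ (4 * (w * n))" unfolding G_def using g2 by (intro power_mono) auto
      ultimately have "(w * n + 2 * e) * G \<le> 2 ^ (w * n + 2 * e * n) * (2 ^ g) ^ (4 * (w * n))"
        by (intro mult_le_mono)
      also have "\<dots> = 2 ^ (C * n)"
        by (simp add: C_def algebra_simps flip: power_mult power_add)
      finally show "(w * n + 2 * e) * G \<le> 2 ^ (C * n)" .
    qed auto
    finally have "real (w * n * e ^ (2 * G)) \<le> real (2 ^ (2 ^ (C * n)))" by (rule of_nat_mono)
    also have "\<dots> = 2 powr (2 powr (real C * real n))"
      by (simp flip: of_nat_mult powr_realpow)
    finally show ?thesis unfolding G(1) .
  qed
  then show ?thesis unfolding e_def g_def by blast
qed

section \<open>From homogeneous subsequences to predicates\<close>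

primrec sa_atoms :: "sa_formula \<Rightarrow> rat_mpoly set" where
  "sa_atoms (PolyEq p) = {p}"
| "sa_atoms (PolyGt p) = {p}"
| "sa_atoms (PolyGe p) = {p}"
| "sa_atoms (Neg f) = sa_atoms f"
| "sa_atoms (Conj f g) = sa_atoms f \<union> sa_atoms g"
| "sa_atoms (Disj f g) = sa_atoms f \<union> sa_atoms g"

lemma finite_sa_atoms: "finite (sa_atoms f)"
  by (induction f) auto

lemma mpoly_vars_sa_atoms: "p \<in> sa_atoms f \<Longrightarrow> mpoly_vars p \<subseteq> sa_vars f"
  by (induction f) auto

text \<open>Every atom compares a polynomial with 0, so its truth is a function of the sign.\<close>

lemma sa_holds_cong_sgn:
  assumes "\<And>p. p \<in> sa_atoms f \<Longrightarrow> sgn (mpoly_eval p x) = sgn (mpoly_eval p y)"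
  shows "sa_holds f x = sa_holds f y"
proof -
  have "(a > 0) = (b > 0)" "(a \<ge> 0) = (b \<ge> 0)" "(a = 0) = (b = 0)" if "sgn a = sgn b" for a b :: real
    using that by (auto simp: sgn_if split: if_splits)
  note sgn_cong = this
  from assms show ?thesis
  proof (induction f)
    case (PolyEq p)
    then have "sgn (mpoly_eval p x) = sgn (mpoly_eval p y)" by simp
    from sgn_cong(3)[OF this] show ?case by simp
  next
    case (PolyGt p)
    then have "sgn (mpoly_eval p x) = sgn (mpoly_eval p y)" by simp
    from sgn_cong(1)[OF this] show ?case by simp
  next
    case (PolyGe p)
    then have "sgn (mpoly_eval p x) = sgn (mpoly_eval p y)" by simp
    from sgn_cong(2)[OF this] show ?case by simp
  qed simp_all
qed

lemma mpoly_eval_cong: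
  assumes "\<And>i. i \<in> mpoly_vars p \<Longrightarrow> x i = y i"
  shows "mpoly_eval p x = mpoly_eval p y"
  unfolding mpoly_eval_def
proof (intro sum.cong refl)
  fix m assume "m \<in> Poly_Mapping.keys p"
  then have "x i = y i" if "i \<in> Poly_Mapping.keys m" for i
    using assms that unfolding mpoly_vars_def by blast
  then show "of_rat (Poly_Mapping.lookup p m) * (\<Prod>i\<in>Poly_Mapping.keys m. x i ^ Poly_Mapping.lookup m i) =
      of_rat (Poly_Mapping.lookup p m) * (\<Prod>i\<in>Poly_Mapping.keys m. y i ^ Poly_Mapping.lookup m i)"
    by simp
qed

lemma increasing_tuple_nth:
  assumes "sorted_wrt (<) is" "set is \<subseteq> J" "length is = k"
  shows "increasing_tuple k J ((!) is)"
  using assms unfolding increasing_tuple_def strict_mono_on_def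
  by (auto simp: sorted_wrt_iff_nth_less)

text \<open>Recovers positions, which a subsequence of values alone does not determine when values
  repeat.\<close>

lemma subseq_sorted_indices:
  assumes "subseq cs (map f js)" "sorted_wrt (<) js"
  obtains ls where "cs = map f ls" "sorted_wrt (<) ls" "set ls \<subseteq> set js"
proof -
  obtain N where N: "cs = map f (nths js N)"
    using assms(1) unfolding subseq_conv_nths nths_map by blast
  have "sorted_wrt (<) (nths js N)"
    using assms(2) by (induction js arbitrary: N) (auto simp: nths_Cons dest: in_set_nthsD)
  then show thesis using that N set_nths_subset by metis
qed

text \<open>Homogeneity makes each predicate constant on increasing tuples from \<open>J\<close>.
  The Erdos-Szekeres property, applied to the first \<open>N\<close> terms with target length
  \<open>K\<close>, yields one tuple satisfying some predicate, and constancy carries this over to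
  all tuples from the first \<open>n\<close> terms.\<close>

lemma ES_property_of_homogeneous:
  fixes \<Phi> :: "real predicate set"
  assumes \<phi>: "\<And>\<phi>. \<phi> \<in> \<Phi> \<Longrightarrow> sa_vars (F \<phi>) \<subseteq> {..<arity \<phi>} \<and>
       (\<forall>xs. length xs = arity \<phi> \<longrightarrow> (pred_holds \<phi> xs \<longleftrightarrow> sa_holds (F \<phi>) (\<lambda>i. xs ! i)))"
    and K: "\<And>\<phi>. \<phi> \<in> \<Phi> \<Longrightarrow> arity \<phi> \<le> K" and N: "ES_property \<Phi> K N"
    and J: "finite J" "J \<subseteq> {..<length as}" "n \<le> card J" "N \<le> card J"
    and hom: "\<And>\<phi> p. \<phi> \<in> \<Phi> \<Longrightarrow> p \<in> sa_atoms (F \<phi>) \<Longrightarrow> homogeneous (arity \<phi>) p ((!) as) J"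
  shows "\<exists>bs. subseq bs as \<and> length bs = n \<and> (\<exists>\<phi>\<in>\<Phi>. holds_everywhere \<phi> bs)"
proof -
  define js where "js = sorted_list_of_set J"
  have js: "sorted_wrt (<) js" "set js = J" "length js = card J"
    using J(1) by (simp_all add: js_def)
  have sub: "subseq (map ((!) as) (take m js)) as" for m
  proof -
    have "subseq (take m js) [0..<length as]"
    proof (rule sorted_subset_imp_subseq)
      show "set (take m js) \<subseteq> set [0..<length as]" using set_take_subset[of m js] js(2) J(2) by auto
      show "sorted_wrt (<) (take m js)" using js(1) by (rule sorted_wrt_take)
    qed simp
    then have "subseq (map ((!) as) (take m js)) (map ((!) as) [0..<length as])" by (rule subseq_map)
    then show ?thesis by (simp add: map_nth)
  qed
  have same: "pred_holds \<phi> (map ((!) as) is) = pred_holds \<phi> (map ((!) as) ls)"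
    if "\<phi> \<in> \<Phi>" and i: "sorted_wrt (<) is" "set is \<subseteq> J" "length is = arity \<phi>"
      and l: "sorted_wrt (<) ls" "set ls \<subseteq> J" "length ls = arity \<phi>" for \<phi> "is" ls
  proof -
    have "sgn (mpoly_eval p ((!) (map ((!) as) is))) = sgn (mpoly_eval p ((!) (map ((!) as) ls)))"
      if p: "p \<in> sa_atoms (F \<phi>)" for p
    proof -
      have vars: "mpoly_vars p \<subseteq> {..<arity \<phi>}"
        using mpoly_vars_sa_atoms[OF p] \<phi>[OF \<open>\<phi> \<in> \<Phi>\<close>] by blast
      have "mpoly_eval p ((!) (map ((!) as) xs)) = mpoly_eval p (\<lambda>j. as ! (xs ! j))"
        if "length xs = arity \<phi>" for xs
        using vars that by (intro mpoly_eval_cong) auto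
      moreover have "sgn (mpoly_eval p (\<lambda>j. as ! (is ! j))) = sgn (mpoly_eval p (\<lambda>j. as ! (ls ! j)))"
        using hom[OF \<open>\<phi> \<in> \<Phi>\<close> p] increasing_tuple_nth[OF i] increasing_tuple_nth[OF l]
        unfolding homogeneous_def by metis
      ultimately show ?thesis using i l by simp
    qed
    then have "sa_holds (F \<phi>) ((!) (map ((!) as) is)) = sa_holds (F \<phi>) ((!) (map ((!) as) ls))"
      by (rule sa_holds_cong_sgn)
    moreover have "pred_holds \<phi> (map ((!) as) xs) = sa_holds (F \<phi>) ((!) (map ((!) as) xs))"
      if "length xs = arity \<phi>" for xs
      using \<phi>[OF \<open>\<phi> \<in> \<Phi>\<close>] that by simp
    ultimately show ?thesis using i(3) l(3) by simp
  qed
  have len_N: "length (map ((!) as) (take N js)) = N" using js(3) J(4) by simp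
  obtain cs \<phi> where cs: "subseq cs (map ((!) as) (take N js))" "length cs = K"
    and \<phi>\<Phi>: "\<phi> \<in> \<Phi>" and ev: "holds_everywhere \<phi> cs"
    using N[unfolded ES_property_def, rule_format, OF len_N] by blast
  obtain ls where ls: "cs = map ((!) as) ls" "sorted_wrt (<) ls" "set ls \<subseteq> set (take N js)"
    using subseq_sorted_indices[OF cs(1) sorted_wrt_take[OF js(1)]] by blast
  let ?k = "arity \<phi>"
  have k: "?k \<le> length ls" using K[OF \<phi>\<Phi>] cs(2) ls(1) by simp
  \<comment> \<open>Since \<open>cs\<close> is at least as long as the arity, holding everywhere is
    not vacuous: the first \<open>?k\<close> entries form a tuple.\<close>
  have "pred_holds \<phi> (map ((!) cs) [0..<?k])"
  proof (rule ev[unfolded holds_everywhere_def, rule_format])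
    show "length [0..<?k] = arity \<phi> \<and> set [0..<?k] \<subseteq> {..<length cs} \<and> sorted_wrt (<) [0..<?k]"
      using k ls(1) by auto
  qed
  moreover have "map ((!) cs) [0..<?k] = map ((!) as) (take ?k ls)"
    unfolding ls(1) using k by (intro nth_equalityI) simp_all
  ultimately have pos: "pred_holds \<phi> (map ((!) as) (take ?k ls))" by simp
  have lsJ: "sorted_wrt (<) (take ?k ls)" "set (take ?k ls) \<subseteq> J" "length (take ?k ls) = ?k"
  proof -
    show "sorted_wrt (<) (take ?k ls)" using ls(2) by (rule sorted_wrt_take)
    show "set (take ?k ls) \<subseteq> J"
      using set_take_subset[of ?k ls] set_take_subset[of N js] ls(3) js(2) by blast
    show "length (take ?k ls) = ?k" using k by simp
  qed
  have "holds_everywhere \<phi> (map ((!) as) (take n js))"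
    unfolding holds_everywhere_def
  proof (intro allI impI)
    fix "is" assume *: "length is = arity \<phi> \<and> set is \<subseteq> {..<length (map ((!) as) (take n js))} \<and> sorted_wrt (<) is"
    have less: "i < n" "i < length js" if "i \<in> set is" for i using * that by auto
    have eq: "map ((!) (map ((!) as) (take n js))) is = map ((!) as) (map ((!) js) is)"
      using less by auto
    have srt: "sorted_wrt (<) (map ((!) js) is)"
      unfolding sorted_wrt_map
    proof (rule sorted_wrt_mono_rel[of _ "(<)"])
      show "js ! x < js ! y" if "x \<in> set is" "y \<in> set is" "x < y" for x y
        using js(1) that less unfolding sorted_wrt_iff_nth_less by blast
    qed (use * in simp)
    have sub_J: "set (map ((!) js) is) \<subseteq> J" using less js(2) by auto
    have len_k: "length (map ((!) js) is) = arity \<phi>" using * by simp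
    show "pred_holds \<phi> (map ((!) (map ((!) as) (take n js))) is)"
      unfolding eq using same[OF \<phi>\<Phi> srt sub_J len_k lsJ] pos by blast
  qed
  moreover have "length (map ((!) as) (take n js)) = n" using js(3) J(3) by simp
  ultimately show ?thesis using sub \<phi>\<Phi> by blast
qed

section \<open>Choice of the constants and conclusion\<close>

theorem theorem4:
  fixes \<Phi> :: "real predicate set"
  assumes "finite \<Phi>"
    and "\<And>\<phi>. \<phi> \<in> \<Phi> \<Longrightarrow> semialgebraic1 \<phi>"
    and "erdos_szekeres \<Phi>"
  shows "\<exists>C::real. \<forall>n\<ge>1. real (ES \<Phi> n) \<le> 2 powr (2 powr (C * real n))"
proof -
  obtain F where F: "\<And>\<phi>. \<phi> \<in> \<Phi> \<Longrightarrow> sa_vars (F \<phi>) \<subseteq> {..<arity \<phi>} \<and>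
       (\<forall>xs. length xs = arity \<phi> \<longrightarrow> (pred_holds \<phi> xs \<longleftrightarrow> sa_holds (F \<phi>) (\<lambda>i. xs ! i)))"
    using assms(2) unfolding semialgebraic1_def by metis
  \<comment> \<open>Arities are recorded with the polynomials, as homogeneity depends on the tuple
    length and one polynomial may occur in predicates of different arities.\<close>
  define A where "A = (\<Union>\<phi>\<in>\<Phi>. (\<lambda>p. (arity \<phi>, p)) ` sa_atoms (F \<phi>))"
  have A: "finite A" using assms(1) by (simp add: A_def finite_sa_atoms)
  have A_vars: "mpoly_vars p \<subseteq> {..<k}" if "(k, p) \<in> A" for k p
    using that F mpoly_vars_sa_atoms unfolding A_def by fastforce
  obtain D0 W where W: "W \<ge> 1" and hom: "\<forall>D J z a r n. D0 \<le> D \<longrightarrow> spread D J z \<longrightarrow> finite J \<longrightarrow>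
      W * n \<le> card J \<longrightarrow> 3 \<le> n \<longrightarrow>
      (\<exists>K\<subseteq>J. n \<le> card K \<and> (\<forall>(k, p)\<in>A. homogeneous k p (\<lambda>i. a + r * exp (z i)) K))"
    using spread_ex_homogeneous[OF A A_vars] by blast
  \<comment> \<open>Inserting 0 avoids a separate argument that \<Phi> is nonempty.\<close>
  define K where "K = Max (insert 0 (arity ` \<Phi>))"
  have K: "arity \<phi> \<le> K" if "\<phi> \<in> \<Phi>" for \<phi> using assms(1) that by (simp add: K_def)
  obtain N where N: "ES_property \<Phi> K N" using assms(3) unfolding erdos_szekeres_def by blast
  \<comment> \<open>\<open>Suc\<close> secures the \<open>D >= 1\<close> that separation
    requires.\<close>
  define D where "D = Suc D0"
  \<comment> \<open>After the loss of the factor \<open>W\<close> there remain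
    \<open>(N + 3) * n\<close> indices, enough at once for the lower bound 3, for \<open>n\<close>
    and for \<open>N\<close>.\<close>
  define w where "w = W * (N + 3)"
  define L where "L n = (w * n) * (2 * 3 ^ D + 1) ^
      (2 * ((2 * D + 1) ^ (2 * (w * n)) * (2 * D + 1) ^ (2 * (w * n))))" for n
  have "ES_property \<Phi> n (L n)" if n: "n \<ge> 1" for n
    unfolding ES_property_def
  proof (intro allI impI)
    fix as :: "real list" assume len: "length as = L n"
    have "w * n \<ge> 1" using W n by (simp add: w_def)
    then obtain J z a r where J: "J \<subseteq> {..<length as}" "w * n \<le> card J" "spread D J z"
      and eq: "\<And>i. i \<in> J \<Longrightarrow> as ! i = a + r * exp (z i)"
      using ex_affine_exp_spread[of "{..<length as}" D "w * n" "(!) as"] len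
      unfolding L_def D_def by auto
    have "(N + 3) * 1 \<le> (N + 3) * n" using n by (intro mult_le_mono) auto
    then have n3: "3 \<le> (N + 3) * n" "n \<le> (N + 3) * n" "N \<le> (N + 3) * n"
      unfolding mult_1_right by (linarith, simp, linarith)
    have "finite J" using J(1) finite_subset by blast
    moreover have "W * ((N + 3) * n) \<le> card J" using J(2) by (simp add: w_def mult.assoc)
    ultimately obtain M where M: "M \<subseteq> J" "(N + 3) * n \<le> card M"
      and homM: "\<forall>(k, p)\<in>A. homogeneous k p (\<lambda>i. a + r * exp (z i)) M"
      using hom[rule_format, of D J z "(N + 3) * n" a r] J(3) n3(1) by (auto simp: D_def)
    have homM': "homogeneous (arity \<phi>) p ((!) as) M" if "\<phi> \<in> \<Phi>" "p \<in> sa_atoms (F \<phi>)" for \<phi> p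
    proof -
      have vars: "mpoly_vars p \<subseteq> {..<arity \<phi>}" using that A_vars unfolding A_def by blast
      have "mpoly_eval p (\<lambda>j. as ! u j) = mpoly_eval p (\<lambda>j. a + r * exp (z (u j)))"
        if "increasing_tuple (arity \<phi>) M u" for u
        using vars that M(1) eq unfolding increasing_tuple_def by (intro mpoly_eval_cong) blast
      moreover have "homogeneous (arity \<phi>) p (\<lambda>i. a + r * exp (z i)) M"
        using homM that unfolding A_def by blast
      ultimately show ?thesis unfolding homogeneous_def by metis
    qed
    have M': "finite M" "M \<subseteq> {..<length as}"
      using M(1) J(1) \<open>finite J\<close> finite_subset by (blast, blast)
    show "\<exists>bs. subseq bs as \<and> length bs = n \<and> (\<exists>\<phi>\<in>\<Phi>. holds_everywhere \<phi> bs)"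
    proof (rule ES_property_of_homogeneous[where \<Phi> = \<Phi> and F = F and J = M])
      show "n \<le> card M" "N \<le> card M"
        using le_trans[OF n3(2) M(2)] le_trans[OF n3(3) M(2)] .
    qed (fact F K N M' homM')+
  qed
  then have le: "ES \<Phi> n \<le> L n" if "n \<ge> 1" for n
    unfolding ES_def using that by (intro Least_le)
  obtain C where C: "\<forall>n\<ge>1. real (L n) \<le> 2 powr (2 powr (C * real n))"
    using double_exponential_bound[of w D] unfolding L_def by blast
  show ?thesis
  proof (intro exI allI impI)
    fix n :: nat assume n: "n \<ge> 1"
    have "real (ES \<Phi> n) \<le> real (L n)" using le[OF n] by simp
    also have "\<dots> \<le> 2 powr (2 powr (C * real n))" using C n by blast
    finally show "real (ES \<Phi> n) \<le> 2 powr (2 powr (C * real n))" .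
  qed
qed

end
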